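(* The Boolean query EVEN is not definable in the logic $\mathcal L$: there is no sentence $\phi$ of $\mathcal L[\{E\}]$ such that for every finite graph $\mathcal G$ with vertex set $V$, $\mathcal G\models\phi$ iff $|V|$ is even.
   Context: Graphs are finite structures over the signature $\{E\}$ with $E$ binary. $\log(n)=\lceil\log_2 n\rceil$, $\log^k(n)=(\log(n))^k$. $\mathscr L^\omega_{\infty\omega}=\bigcup_s\mathscr L^s_{\infty\omega}$, where $\mathscr L^s_{\infty\omega}$ is infinitary logic (first-order logic with arbitrary infinite conjunctions and disjunctions) with at most $s$ element variables. For $k>0$, $\exists^{\log^k}$ is the second-order quantifier with $\mathscr A\models\exists^{\log^k}X\phi$ iff there is $S\subseteq A^{\mathrm{arity}(X)}$ with $|S|\le\log^k(|A|)$ such that $\mathscr A\models\phi[X/S]$, and $\forall^{\log^k}X:=\neg\exists^{\log^k}X\neg$. The logic $\mathcal L$ is the smallest class of formulas containing all $\mathscr L^\omega_{\infty\omega}$-formulas and closed under forming $\exists^{\log^k}X\phi$ and $\forall^{\log^k}X\phi$ (for $k>0$ and $X$ a relation variable), $\psi\wedge\chi$ and $\psi\vee\chi$. *)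

theory Defs
  imports Complex_Main "HOL-Library.Infinite_Typeclass"
begin

datatype rvar = RVar (name: nat) (arity: nat)

text \<open>
  The type parameter \<open>'i\<close> bounds the size of the families that may occur in infinitary
  conjunctions and disjunctions; it is left arbitrary. The constructors \<open>BigAnd I F\<close> and
  \<open>BigOr I F\<close> denote the conjunction and disjunction of the family \<open>(F i)\<close> for \<open>i\<close> in \<open>I\<close>.
  The type contains more formulas than are used below, e.g. second-order quantifiers inside
  infinitary conjunctions; the logics are carved out as subsets.
\<close>

datatype 'i fm =
    Eq nat nat
  | Edge nat nat
  | Rel rvar "nat list"
  | Neg "'i fm"
  | And "'i fm" "'i fm"
  | Or "'i fm" "'i fm"
  | BigAnd "'i set" "'i \<Rightarrow> 'i fm"
  | BigOr "'i set" "'i \<Rightarrow> 'i fm"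
  | Ex nat "'i fm"
  | All nat "'i fm"
  | ExLog nat rvar "'i fm"

abbreviation AllLog :: "nat \<Rightarrow> rvar \<Rightarrow> 'i fm \<Rightarrow> 'i fm" where
  "AllLog k X \<phi> \<equiv> Neg (ExLog k X (Neg \<phi>))"

text \<open>All element variables of a formula, free or bound.\<close>

primrec elem_vars :: "'i fm \<Rightarrow> nat set" where
  "elem_vars (Eq x y) = {x, y}"
| "elem_vars (Edge x y) = {x, y}"
| "elem_vars (Rel X xs) = set xs"
| "elem_vars (Neg \<phi>) = elem_vars \<phi>"
| "elem_vars (And \<phi> \<psi>) = elem_vars \<phi> \<union> elem_vars \<psi>"
| "elem_vars (Or \<phi> \<psi>) = elem_vars \<phi> \<union> elem_vars \<psi>"
| "elem_vars (BigAnd I F) = (\<Union>i\<in>I. elem_vars (F i))"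
| "elem_vars (BigOr I F) = (\<Union>i\<in>I. elem_vars (F i))"
| "elem_vars (Ex x \<phi>) = insert x (elem_vars \<phi>)"
| "elem_vars (All x \<phi>) = insert x (elem_vars \<phi>)"
| "elem_vars (ExLog k X \<phi>) = elem_vars \<phi>"

primrec free_elem_vars :: "'i fm \<Rightarrow> nat set" where
  "free_elem_vars (Eq x y) = {x, y}"
| "free_elem_vars (Edge x y) = {x, y}"
| "free_elem_vars (Rel X xs) = set xs"
| "free_elem_vars (Neg \<phi>) = free_elem_vars \<phi>"
| "free_elem_vars (And \<phi> \<psi>) = free_elem_vars \<phi> \<union> free_elem_vars \<psi>"
| "free_elem_vars (Or \<phi> \<psi>) = free_elem_vars \<phi> \<union> free_elem_vars \<psi>"
| "free_elem_vars (BigAnd I F) = (\<Union>i\<in>I. free_elem_vars (F i))"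
| "free_elem_vars (BigOr I F) = (\<Union>i\<in>I. free_elem_vars (F i))"
| "free_elem_vars (Ex x \<phi>) = free_elem_vars \<phi> - {x}"
| "free_elem_vars (All x \<phi>) = free_elem_vars \<phi> - {x}"
| "free_elem_vars (ExLog k X \<phi>) = free_elem_vars \<phi>"

primrec free_rel_vars :: "'i fm \<Rightarrow> rvar set" where
  "free_rel_vars (Eq x y) = {}"
| "free_rel_vars (Edge x y) = {}"
| "free_rel_vars (Rel X xs) = {X}"
| "free_rel_vars (Neg \<phi>) = free_rel_vars \<phi>"
| "free_rel_vars (And \<phi> \<psi>) = free_rel_vars \<phi> \<union> free_rel_vars \<psi>"
| "free_rel_vars (Or \<phi> \<psi>) = free_rel_vars \<phi> \<union> free_rel_vars \<psi>"
| "free_rel_vars (BigAnd I F) = (\<Union>i\<in>I. free_rel_vars (F i))"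
| "free_rel_vars (BigOr I F) = (\<Union>i\<in>I. free_rel_vars (F i))"
| "free_rel_vars (Ex x \<phi>) = free_rel_vars \<phi>"
| "free_rel_vars (All x \<phi>) = free_rel_vars \<phi>"
| "free_rel_vars (ExLog k X \<phi>) = free_rel_vars \<phi> - {X}"

definition sentence :: "'i fm \<Rightarrow> bool" where
  "sentence \<phi> \<longleftrightarrow> free_elem_vars \<phi> = {} \<and> free_rel_vars \<phi> = {}"

text \<open>
  Formulas of infinitary logic: no second-order quantifier occurs, and relation variables are
  applied to tuples of the right length. Free relation variables are allowed.
\<close>

primrec infinitary :: "'i fm \<Rightarrow> bool" where
  "infinitary (Eq x y) = True"
| "infinitary (Edge x y) = True"
| "infinitary (Rel X xs) = (length xs = arity X)"
| "infinitary (Neg \<phi>) = infinitary \<phi>"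
| "infinitary (And \<phi> \<psi>) = (infinitary \<phi> \<and> infinitary \<psi>)"
| "infinitary (Or \<phi> \<psi>) = (infinitary \<phi> \<and> infinitary \<psi>)"
| "infinitary (BigAnd I F) = (\<forall>i\<in>I. infinitary (F i))"
| "infinitary (BigOr I F) = (\<forall>i\<in>I. infinitary (F i))"
| "infinitary (Ex x \<phi>) = infinitary \<phi>"
| "infinitary (All x \<phi>) = infinitary \<phi>"
| "infinitary (ExLog k X \<phi>) = False"

definition Linf :: "nat \<Rightarrow> 'i fm set" where
  "Linf s = {\<phi>. infinitary \<phi> \<and> finite (elem_vars \<phi>) \<and> card (elem_vars \<phi>) \<le> s}"

definition Linf_omega :: "'i fm set" where
  "Linf_omega = (\<Union>s. Linf s)"

inductive_set Llog :: "'i fm set" where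
  Linf: "\<phi> \<in> Linf_omega \<Longrightarrow> \<phi> \<in> Llog"
| ExLog: "\<phi> \<in> Llog \<Longrightarrow> k > 0 \<Longrightarrow> ExLog k X \<phi> \<in> Llog"
| AllLog: "\<phi> \<in> Llog \<Longrightarrow> k > 0 \<Longrightarrow> AllLog k X \<phi> \<in> Llog"
| And: "\<psi> \<in> Llog \<Longrightarrow> \<chi> \<in> Llog \<Longrightarrow> And \<psi> \<chi> \<in> Llog"
| Or: "\<psi> \<in> Llog \<Longrightarrow> \<chi> \<in> Llog \<Longrightarrow> Or \<psi> \<chi> \<in> Llog"

definition finite_graph :: "'v set \<Rightarrow> ('v \<times> 'v) set \<Rightarrow> bool" where
  "finite_graph V E \<longleftrightarrow> finite V \<and> V \<noteq> {} \<and> E \<subseteq> V \<times> V"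

definition tuples :: "'v set \<Rightarrow> nat \<Rightarrow> 'v list set" where
  "tuples V r = {xs. set xs \<subseteq> V \<and> length xs = r}"

definition clog :: "nat \<Rightarrow> nat" where
  "clog n = nat \<lceil>log 2 (real n)\<rceil>"

primrec sat :: "'v set \<Rightarrow> ('v \<times> 'v) set \<Rightarrow> 'i fm \<Rightarrow> (nat \<Rightarrow> 'v) \<Rightarrow> (rvar \<Rightarrow> 'v list set) \<Rightarrow> bool" where
  "sat V E (Eq x y) a \<rho> \<longleftrightarrow> a x = a y"
| "sat V E (Edge x y) a \<rho> \<longleftrightarrow> (a x, a y) \<in> E"
| "sat V E (Rel X xs) a \<rho> \<longleftrightarrow> map a xs \<in> \<rho> X"
| "sat V E (Neg \<phi>) a \<rho> \<longleftrightarrow> \<not> sat V E \<phi> a \<rho>"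
| "sat V E (And \<phi> \<psi>) a \<rho> \<longleftrightarrow> sat V E \<phi> a \<rho> \<and> sat V E \<psi> a \<rho>"
| "sat V E (Or \<phi> \<psi>) a \<rho> \<longleftrightarrow> sat V E \<phi> a \<rho> \<or> sat V E \<psi> a \<rho>"
| "sat V E (BigAnd I F) a \<rho> \<longleftrightarrow> (\<forall>i\<in>I. sat V E (F i) a \<rho>)"
| "sat V E (BigOr I F) a \<rho> \<longleftrightarrow> (\<exists>i\<in>I. sat V E (F i) a \<rho>)"
| "sat V E (Ex x \<phi>) a \<rho> \<longleftrightarrow> (\<exists>v\<in>V. sat V E \<phi> (a(x := v)) \<rho>)"
| "sat V E (All x \<phi>) a \<rho> \<longleftrightarrow> (\<forall>v\<in>V. sat V E \<phi> (a(x := v)) \<rho>)"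
| "sat V E (ExLog k X \<phi>) a \<rho> \<longleftrightarrow>
     (\<exists>S \<subseteq> tuples V (arity X). card S \<le> clog (card V) ^ k \<and> sat V E \<phi> a (\<rho>(X := S)))"

text \<open>For a sentence, the truth value does not depend on the assignments quantified here.\<close>

definition models :: "'v set \<Rightarrow> ('v \<times> 'v) set \<Rightarrow> 'i fm \<Rightarrow> bool" where
  "models V E \<phi> \<longleftrightarrow>
     (\<forall>a \<rho>. range a \<subseteq> V \<longrightarrow> (\<forall>X. \<rho> X \<subseteq> tuples V (arity X)) \<longrightarrow> sat V E \<phi> a \<rho>)"

end

theory Submission
  imports Defs "HOL-Real_Asymp.Real_Asymp"
begin

text \<open>
  Two edgeless graphs whose orders are large and have the same rounded logarithm \<open>m\<close> cannot be
  told apart. A relation of size at most \<open>m ^ k\<close> touches only polylogarithmically many vertices,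
  so a partial injection between the two vertex sets that carries the relations chosen so far to
  each other can be extended to the support of the next one. Outside the supports both structures
  are bare sets, on which the pebble game for infinitary logic is won as long as enough vertices
  remain. Orders \<open>2 ^ m - 1\<close> and \<open>2 ^ m\<close> have different parity and equal rounded logarithm.
\<close>

section \<open>Partial injections that carry relations along\<close>

text \<open>All relations are required to live on \<open>U\<close>, so the points outside it look
  alike and can be paired freely later. Because \<rho>' is exactly the image of \<rho> and
  \<open>f\<close> is injective on \<open>U\<close>, this is a partial isomorphism in both
  directions. Edges need no clause, as it is only used for edgeless graphs.\<close>

definition matching ::
  "('v \<Rightarrow> 'w) \<Rightarrow> 'v set \<Rightarrow> 'v set \<Rightarrow> 'w set \<Rightarrow> (rvar \<Rightarrow> 'v list set) \<Rightarrow> (rvar \<Rightarrow> 'w list set) \<Rightarrow> bool"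
  where
  "matching f U V V' \<rho> \<rho>' \<longleftrightarrow> inj_on f U \<and> U \<subseteq> V \<and> f ` U \<subseteq> V' \<and>
     (\<forall>X. \<rho> X \<subseteq> lists U \<and> \<rho>' X = map f ` \<rho> X)"

text \<open>Used to lift pebbles: positions may be forgotten as long as the supports of the
  relations stay in the domain.\<close>

lemma matching_subset:
  assumes "matching f U V V' \<rho> \<rho>'" "W \<subseteq> U" "\<And>X. \<rho> X \<subseteq> lists W"
  shows "matching f W V V' \<rho> \<rho>'"
proof -
  have "W \<subseteq> V" "f ` W \<subseteq> V'" "inj_on f W"
    using assms(1,2) inj_on_subset[of f U W] by (auto simp: matching_def)
  then show ?thesis using assms by (simp add: matching_def)
qed

lemma map_image_cong:
  assumes "S \<subseteq> lists U" "\<And>u. u \<in> U \<Longrightarrow> h u = f u"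
  shows "map h ` S = map f ` S"
proof (rule image_cong[OF refl])
  fix xs assume "xs \<in> S"
  then show "map h xs = map f xs"
    using assms by (auto simp: in_lists_conv_set)
qed

text \<open>New points are paired outside both the old domain and the old range, so gluing preserves
  injectivity. The relations see only \<open>U\<close>, where the map is unchanged.\<close>

lemma matching_extend:
  assumes m: "matching f U V V' \<rho> \<rho>'"
    and T: "T \<subseteq> V - U" "T' \<subseteq> V' - f ` U" and g: "bij_betw g T T'"
  shows "\<exists>h. matching h (U \<union> T) V V' \<rho> \<rho>' \<and> (\<forall>u\<in>U. h u = f u) \<and> h ` T = T'"
proof -
  define h where "h x = (if x \<in> U then f x else g x)" for x
  have hU: "h u = f u" if "u \<in> U" for u using that by (simp add: h_def)
  have hT: "h x = g x" if "x \<in> T" for x using that T(1) by (auto simp: h_def)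
  have imgT: "h ` T = T'" using g hT unfolding bij_betw_def by (metis image_cong)
  have imgU: "h ` U = f ` U" using hU by (rule image_cong[OF refl])
  have "inj_on h T" using g hT unfolding bij_betw_def by (metis inj_on_cong)
  moreover have "inj_on h U" using m hU unfolding matching_def by (metis inj_on_cong)
  moreover have "h ` (U - T) \<inter> h ` (T - U) = {}"
  proof -
    have "h ` (U - T) \<subseteq> f ` U" "h ` (T - U) \<subseteq> T'" using imgT imgU by auto
    then show ?thesis using T(2) by auto
  qed
  ultimately have "inj_on h (U \<union> T)" by (simp add: inj_on_Un)
  moreover have "U \<union> T \<subseteq> V" using m T(1) by (auto simp: matching_def)
  moreover have "h ` (U \<union> T) \<subseteq> V'"
    using imgT imgU T(2) m by (auto simp: matching_def image_Un)
  moreover have "\<rho>' X = map h ` \<rho> X" for X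
    using map_image_cong[of "\<rho> X" U h f] m hU by (simp add: matching_def)
  moreover have "\<rho> X \<subseteq> lists (U \<union> T)" for X
    by (rule order_trans[OF _ lists_mono[OF Un_upper1]]) (use m in \<open>simp add: matching_def\<close>)
  ultimately have "matching h (U \<union> T) V V' \<rho> \<rho>'" unfolding matching_def by simp
  with hU imgT show ?thesis by blast
qed

lemma card_image_matching:
  assumes "matching f U V V' \<rho> \<rho>'"
  shows "card (f ` U) = card U"
  using assms by (simp add: matching_def card_image)

lemma obtain_fresh_subset:
  assumes "finite V" "W \<subseteq> V" "card W + n \<le> card V"
  obtains T where "T \<subseteq> V - W" "card T = n" "finite T"
proof -
  have "n \<le> card (V - W)"
    using assms by (simp add: card_Diff_subset finite_subset)
  then show ?thesis using that obtain_subset_with_card_n by metis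
qed

lemma matching_forth:
  assumes m: "matching f U V V' \<rho> \<rho>'" and fin: "finite V" "finite V'"
    and T: "T \<subseteq> V" and le: "card U + card T \<le> card V'"
  shows "\<exists>h. matching h (U \<union> T) V V' \<rho> \<rho>' \<and> (\<forall>u\<in>U. h u = f u)"
proof -
  have finT: "finite T" using T fin finite_subset by blast
  have "card (T - U) \<le> card T" using finT by (simp add: card_mono)
  then obtain T' where T': "T' \<subseteq> V' - f ` U" "card T' = card (T - U)" "finite T'"
    using obtain_fresh_subset[of V' "f ` U" "card (T - U)"] fin le m card_image_matching[OF m]
    unfolding matching_def by auto
  then obtain g where "bij_betw g (T - U) T'"
    using finT finite_same_card_bij[of "T - U" T'] by auto
  then have "\<exists>h. matching h (U \<union> (T - U)) V V' \<rho> \<rho>' \<and> (\<forall>u\<in>U. h u = f u) \<and> h ` (T - U) = T'"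
    using T by (intro matching_extend[OF m _ T'(1)]) auto
  then show ?thesis by auto
qed

lemma matching_back:
  assumes m: "matching f U V V' \<rho> \<rho>'" and fin: "finite V" "finite V'"
    and T: "T \<subseteq> V'" and le: "card U + card T \<le> card V"
  shows "\<exists>h W. matching h (U \<union> W) V V' \<rho> \<rho>' \<and> (\<forall>u\<in>U. h u = f u) \<and>
           W \<subseteq> V \<and> card W \<le> card T \<and> T \<subseteq> h ` (U \<union> W)"
proof -
  have finT: "finite T" using T fin finite_subset by blast
  have le': "card (T - f ` U) \<le> card T" using finT by (simp add: card_mono)
  then obtain W where W: "W \<subseteq> V - U" "card W = card (T - f ` U)" "finite W"
    using obtain_fresh_subset[of V U "card (T - f ` U)"] fin le m
    unfolding matching_def by auto
  then obtain g where "bij_betw g W (T - f ` U)"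
    using finT finite_same_card_bij[of W "T - f ` U"] by auto
  then have "\<exists>h. matching h (U \<union> W) V V' \<rho> \<rho>' \<and> (\<forall>u\<in>U. h u = f u) \<and> h ` W = T - f ` U"
    using T by (intro matching_extend[OF m W(1)]) auto
  then obtain h where h: "matching h (U \<union> W) V V' \<rho> \<rho>'" "\<forall>u\<in>U. h u = f u" "h ` W = T - f ` U"
    by blast
  have "h ` U = f ` U" using h(2) by simp
  then have "T \<subseteq> h ` (U \<union> W)" using h(3) unfolding image_Un by auto
  moreover have "W \<subseteq> V" "card W \<le> card T" using W le' by auto
  ultimately show ?thesis using h(1,2) by blast
qed

text \<open>A tuple in \<rho>' comes from some tuple of \<rho>, possibly a different one; both have
  their entries in \<open>U\<close>, so injectivity forces them to agree.\<close>

lemma matching_Rel: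
  assumes m: "matching f U V V' \<rho> \<rho>'" and xs: "set xs \<subseteq> U"
  shows "map f xs \<in> \<rho>' X \<longleftrightarrow> xs \<in> \<rho> X"
proof
  assume "map f xs \<in> \<rho>' X"
  then obtain ys where ys: "ys \<in> \<rho> X" "map f xs = map f ys"
    using m unfolding matching_def by auto
  then have "set ys \<subseteq> U" using m unfolding matching_def by (metis in_listsD subsetI subsetD)
  then have "inj_on f (set xs \<union> set ys)"
    using m xs unfolding matching_def by (meson Un_least inj_on_subset)
  then show "xs \<in> \<rho> X" using ys map_inj_on by metis
qed (use m in \<open>simp add: matching_def\<close>)

section \<open>The pebble game on edgeless graphs\<close>

text \<open>Lifting pebble \<open>x\<close> before placing it again leaves one free slot within the
  budget, which is where the new position goes.\<close>

lemma card_pebbles: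
  assumes "finite A" "x \<in> A"
  shows "card (U \<union> a ` (A - {x})) + 1 \<le> card U + card A"
proof -
  have "card (U \<union> a ` (A - {x})) \<le> card U + card (a ` (A - {x}))" by (rule card_Un_le)
  also have "\<dots> \<le> card U + card (A - {x})" using assms by (intro add_left_mono card_image_le) simp
  also have "\<dots> + 1 = card U + card A" using card_Suc_Diff1[OF assms] by simp
  finally show ?thesis by simp
qed

text \<open>The pebble \<open>x\<close> is lifted first. The relations live on \<open>U\<close>, so
  forgetting its old position loses none of them, and the remaining matching is then extended by
  \<open>v\<close>.\<close>

lemma pebble_forth:
  assumes m: "matching f (U \<union> a ` A) V V' \<rho> \<rho>'" and b: "\<And>y. y \<in> A \<Longrightarrow> b y = f (a y)"
    and A: "finite A" and x: "x \<in> A" and fin: "finite V" "finite V'" and \<rho>: "\<And>X. \<rho> X \<subseteq> lists U"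
    and le: "card U + card A \<le> card V'" and v: "v \<in> V"
  shows "\<exists>v'\<in>V'. \<exists>h. matching h (U \<union> (a(x := v)) ` A) V V' \<rho> \<rho>' \<and>
           (\<forall>y\<in>A. (b(x := v')) y = h ((a(x := v)) y))"
proof -
  let ?W = "U \<union> a ` (A - {x})"
  have W: "matching f ?W V V' \<rho> \<rho>'"
    by (rule matching_subset[OF m]) (use \<rho> lists_mono[of U ?W] in \<open>blast+\<close>)
  have "card ?W + card {v} \<le> card V'"
    using le card_pebbles[OF A x, of U a] by simp
  from matching_forth[OF W fin _ this] v obtain h
    where h: "matching h (?W \<union> {v}) V V' \<rho> \<rho>'" "\<forall>u\<in>?W. h u = f u" by auto
  have "?W \<union> {v} = U \<union> (a(x := v)) ` A" using x by (auto simp: image_iff)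
  moreover have "h v \<in> V'" using h(1) unfolding matching_def by auto
  moreover have "(b(x := h v)) y = h ((a(x := v)) y)" if "y \<in> A" for y
    using that b h(2) by auto
  ultimately show ?thesis using h(1) by metis
qed

lemma pebble_back:
  assumes m: "matching f (U \<union> a ` A) V V' \<rho> \<rho>'" and b: "\<And>y. y \<in> A \<Longrightarrow> b y = f (a y)"
    and A: "finite A" and x: "x \<in> A" and fin: "finite V" "finite V'" and \<rho>: "\<And>X. \<rho> X \<subseteq> lists U"
    and le: "card U + card A \<le> card V" and v': "v' \<in> V'"
  shows "\<exists>v\<in>V. \<exists>h. matching h (U \<union> (a(x := v)) ` A) V V' \<rho> \<rho>' \<and>
           (\<forall>y\<in>A. (b(x := v')) y = h ((a(x := v)) y))"
proof -
  let ?W = "U \<union> a ` (A - {x})"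
  have W: "matching f ?W V V' \<rho> \<rho>'"
    by (rule matching_subset[OF m]) (use \<rho> lists_mono[of U ?W] in \<open>blast+\<close>)
  have "card ?W + card {v'} \<le> card V"
    using le card_pebbles[OF A x, of U a] by simp
  from matching_back[OF W fin _ this] v' obtain h T
    where h: "matching h (?W \<union> T) V V' \<rho> \<rho>'" "\<forall>u\<in>?W. h u = f u" "v' \<in> h ` (?W \<union> T)"
    by auto
  \<comment> \<open>The preimage may be a point that was already matched or a new one. Restricting
    \<open>h\<close> to \<open>?W\<close> together with \<open>v\<close> handles both cases at
    once.\<close>
  then obtain v where v: "v \<in> ?W \<union> T" "h v = v'" by auto
  have "U \<union> (a(x := v)) ` A = ?W \<union> {v}" using x by (auto simp: image_iff)
  moreover have "matching h (?W \<union> {v}) V V' \<rho> \<rho>'"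
    by (rule matching_subset[OF h(1)]) (use v \<rho> lists_mono[of U "?W \<union> {v}"] in \<open>blast+\<close>)
  moreover have "v \<in> V" using h(1) v(1) unfolding matching_def by blast
  moreover have "(b(x := v')) y = h ((a(x := v)) y)" if "y \<in> A" for y
    using that b h(2) v by auto
  ultimately show ?thesis by metis
qed

text \<open>Without second-order quantifiers the set \<open>U\<close> of supports never grows; only
  the pebbles on the variables in \<open>A\<close> move. The same slack therefore suffices at every
  depth, and arbitrary conjunctions and disjunctions cost nothing.\<close>

lemma infinitary_transfer:
  assumes "infinitary \<phi>" "elem_vars \<phi> \<subseteq> A" and A: "finite A"
    and fin: "finite V" "finite V'"
    and \<rho>: "\<And>X. \<rho> X \<subseteq> lists U"
    and le: "card U + card A \<le> card V" "card U + card A \<le> card V'"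
    and "matching f (U \<union> a ` A) V V' \<rho> \<rho>'" "\<And>x. x \<in> A \<Longrightarrow> b x = f (a x)"
  shows "sat V {} \<phi> a \<rho> \<longleftrightarrow> sat V' {} \<phi> b \<rho>'"
  using assms(1,2,9,10)
proof (induction \<phi> arbitrary: f a b)
  case (Eq x y)
  then show ?case unfolding matching_def by (auto dest: inj_onD)
next
  case (Rel X xs)
  have "map b xs = map f (map a xs)" using Rel by auto
  moreover have "set (map a xs) \<subseteq> U \<union> a ` A" using Rel by auto
  ultimately show ?case using matching_Rel[OF Rel(3)] by (metis sat.simps(3))
next
  case (Neg \<phi>)
  then have "sat V {} \<phi> a \<rho> \<longleftrightarrow> sat V' {} \<phi> b \<rho>'"
    using Neg.IH[OF _ _ Neg.prems(3,4)] by simp_all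
  then show ?case by simp
next
  case (And \<phi> \<psi>)
  then have "sat V {} \<phi> a \<rho> \<longleftrightarrow> sat V' {} \<phi> b \<rho>'" "sat V {} \<psi> a \<rho> \<longleftrightarrow> sat V' {} \<psi> b \<rho>'"
    using And.IH[OF _ _ And.prems(3,4)] by simp_all
  then show ?case by simp
next
  case (Or \<phi> \<psi>)
  then have "sat V {} \<phi> a \<rho> \<longleftrightarrow> sat V' {} \<phi> b \<rho>'" "sat V {} \<psi> a \<rho> \<longleftrightarrow> sat V' {} \<psi> b \<rho>'"
    using Or.IH[OF _ _ Or.prems(3,4)] by simp_all
  then show ?case by simp
next
  case (BigAnd I F)
  have "sat V {} (F i) a \<rho> \<longleftrightarrow> sat V' {} (F i) b \<rho>'" if "i \<in> I" for i
    by (rule BigAnd.IH[OF _ _ _ BigAnd.prems(3,4)]) (use that BigAnd.prems(1,2) in auto)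
  then show ?case by simp
next
  case (BigOr I F)
  have "sat V {} (F i) a \<rho> \<longleftrightarrow> sat V' {} (F i) b \<rho>'" if "i \<in> I" for i
    by (rule BigOr.IH[OF _ _ _ BigOr.prems(3,4)]) (use that BigOr.prems(1,2) in auto)
  then show ?case by simp
next
  case (Ex x \<phi>)
  then have x: "x \<in> A" by simp
  \<comment> \<open>Any reply that restores the invariant will do; the forth and back lemmas provide
    one for a witness from either side.\<close>
  have *: "sat V {} \<phi> (a(x := v)) \<rho> \<longleftrightarrow> sat V' {} \<phi> (b(x := v')) \<rho>'"
    if "matching h (U \<union> (a(x := v)) ` A) V V' \<rho> \<rho>'"
      "\<forall>y\<in>A. (b(x := v')) y = h ((a(x := v)) y)" for h v v'
    by (rule Ex.IH[OF _ _ that(1)]) (use that(2) Ex.prems(1,2) in \<open>auto simp del: fun_upd_apply\<close>)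
  show ?case
    using pebble_forth[OF Ex.prems(3,4) A x fin \<rho> le(2)]
      pebble_back[OF Ex.prems(3,4) A x fin \<rho> le(1)] * unfolding sat.simps by meson
next
  case (All x \<phi>)
  then have x: "x \<in> A" by simp
  have *: "sat V {} \<phi> (a(x := v)) \<rho> \<longleftrightarrow> sat V' {} \<phi> (b(x := v')) \<rho>'"
    if "matching h (U \<union> (a(x := v)) ` A) V V' \<rho> \<rho>'"
      "\<forall>y\<in>A. (b(x := v')) y = h ((a(x := v)) y)" for h v v'
    by (rule All.IH[OF _ _ that(1)]) (use that(2) All.prems(1,2) in \<open>auto simp del: fun_upd_apply\<close>)
  show ?case
    using pebble_forth[OF All.prems(3,4) A x fin \<rho> le(2)]
      pebble_back[OF All.prems(3,4) A x fin \<rho> le(1)] * unfolding sat.simps by meson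
qed simp_all

section \<open>Second-order quantifiers of polylogarithmic size\<close>

text \<open>The number \<open>N\<close> is a reserve of unmatched vertices on both sides, to be
  spent on pebbles and on supports of relations. Bound variables are also asked to start inside
  \<open>U\<close>, so that no pebble begins off the matching; the constant assignments used at the
  end satisfy this.\<close>

definition transfers :: "'v set \<Rightarrow> 'w set \<Rightarrow> nat \<Rightarrow> 'i fm \<Rightarrow> bool" where
  "transfers V V' N \<phi> \<longleftrightarrow> (\<forall>f U a b \<rho> \<rho>'.
     matching f U V V' \<rho> \<rho>' \<longrightarrow> card U + N \<le> card V \<longrightarrow> card U + N \<le> card V' \<longrightarrow>
     a ` elem_vars \<phi> \<subseteq> U \<longrightarrow> (\<forall>x\<in>elem_vars \<phi>. b x = f (a x)) \<longrightarrow>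
     (sat V {} \<phi> a \<rho> \<longleftrightarrow> sat V' {} \<phi> b \<rho>'))"

lemma transfersI:
  assumes "\<And>f U a b \<rho> \<rho>'. matching f U V V' \<rho> \<rho>' \<Longrightarrow> card U + N \<le> card V \<Longrightarrow>
     card U + N \<le> card V' \<Longrightarrow> a ` elem_vars \<phi> \<subseteq> U \<Longrightarrow> \<forall>x\<in>elem_vars \<phi>. b x = f (a x) \<Longrightarrow>
     sat V {} \<phi> a \<rho> \<longleftrightarrow> sat V' {} \<phi> b \<rho>'"
  shows "transfers V V' N \<phi>"
  unfolding transfers_def by (intro allI impI) (rule assms)

lemma transfersD:
  assumes "transfers V V' N \<phi>" "matching f U V V' \<rho> \<rho>'"
    "card U + N \<le> card V" "card U + N \<le> card V'"
    "a ` elem_vars \<phi> \<subseteq> U" "\<And>x. x \<in> elem_vars \<phi> \<Longrightarrow> b x = f (a x)"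
  shows "sat V {} \<phi> a \<rho> \<longleftrightarrow> sat V' {} \<phi> b \<rho>'"
  by (rule assms(1)[unfolded transfers_def, rule_format, OF assms(2-6)])

lemma transfers_mono:
  assumes "transfers V V' N \<phi>" "N \<le> M"
  shows "transfers V V' M \<phi>"
  by (rule transfersI, rule transfersD[OF assms(1)]) (use assms(2) in auto)

text \<open>All pebbles start inside \<open>U\<close>, so a reserve of one vertex per variable is
  enough for the game.\<close>

lemma transfers_infinitary:
  assumes "infinitary \<phi>" "finite (elem_vars \<phi>)" "finite V" "finite V'"
  shows "transfers V V' (card (elem_vars \<phi>)) \<phi>"
proof (rule transfersI)
  fix f U a b \<rho> \<rho>'
  assume m: "matching f U V V' \<rho> \<rho>'" and le: "card U + card (elem_vars \<phi>) \<le> card V"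
    "card U + card (elem_vars \<phi>) \<le> card V'"
    and a: "a ` elem_vars \<phi> \<subseteq> U" and b: "\<forall>x\<in>elem_vars \<phi>. b x = f (a x)"
  have "U \<union> a ` elem_vars \<phi> = U" using a by auto
  then show "sat V {} \<phi> a \<rho> \<longleftrightarrow> sat V' {} \<phi> b \<rho>'"
    using m b by (intro infinitary_transfer[OF assms(1) order_refl assms(2-4) _ le])
      (auto simp: matching_def)
qed

lemma transfers_Neg: "transfers V V' N \<phi> \<Longrightarrow> transfers V V' N (Neg \<phi>)"
  by (simp add: transfers_def)

lemma transfers_And:
  assumes "transfers V V' N \<phi>" "transfers V V' N \<psi>"
  shows "transfers V V' N (And \<phi> \<psi>)"
proof (rule transfersI)
  fix f U a b \<rho> \<rho>'
  assume m: "matching f U V V' \<rho> \<rho>'" "card U + N \<le> card V" "card U + N \<le> card V'"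
    and "a ` elem_vars (And \<phi> \<psi>) \<subseteq> U" "\<forall>x\<in>elem_vars (And \<phi> \<psi>). b x = f (a x)"
  then show "sat V {} (And \<phi> \<psi>) a \<rho> \<longleftrightarrow> sat V' {} (And \<phi> \<psi>) b \<rho>'"
    using transfersD[OF assms(1) m, of a b] transfersD[OF assms(2) m, of a b]
    by (simp add: image_Un)
qed

lemma transfers_Or:
  assumes "transfers V V' N \<phi>" "transfers V V' N \<psi>"
  shows "transfers V V' N (Or \<phi> \<psi>)"
proof (rule transfersI)
  fix f U a b \<rho> \<rho>'
  assume m: "matching f U V V' \<rho> \<rho>'" "card U + N \<le> card V" "card U + N \<le> card V'"
    and "a ` elem_vars (Or \<phi> \<psi>) \<subseteq> U" "\<forall>x\<in>elem_vars (Or \<phi> \<psi>). b x = f (a x)"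
  then show "sat V {} (Or \<phi> \<psi>) a \<rho> \<longleftrightarrow> sat V' {} (Or \<phi> \<psi>) b \<rho>'"
    using transfersD[OF assms(1) m, of a b] transfersD[OF assms(2) m, of a b]
    by (simp add: image_Un)
qed

lemma finite_tuples: "finite V \<Longrightarrow> finite (tuples V r)"
  unfolding tuples_def by (rule finite_lists_length_eq)

text \<open>Each tuple touches at most \<open>r\<close> vertices, so a small relation singles out
  few of them. Finiteness of \<open>V\<close> makes the bound on \<open>card S\<close> genuine,
  since \<open>card\<close> of an infinite set is 0.\<close>

lemma support_tuples:
  assumes "finite V" "S \<subseteq> tuples V r" "card S \<le> n"
  shows "\<Union> (set ` S) \<subseteq> V" "card (\<Union> (set ` S)) \<le> r * n"
proof -
  show "\<Union> (set ` S) \<subseteq> V" using assms(2) unfolding tuples_def by auto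
  have "finite S" using assms finite_tuples finite_subset by blast
  then have "card (\<Union> (set ` S)) \<le> (\<Sum>xs\<in>S. card (set xs))" by (rule card_UN_le)
  also have "\<dots> \<le> (\<Sum>xs\<in>S. r)"
    using assms(2) unfolding tuples_def by (intro sum_mono) (use card_length in blast)
  also have "\<dots> \<le> r * n" using assms(3) by simp
  finally show "card (\<Union> (set ` S)) \<le> r * n" .
qed

lemma map_image_tuples:
  assumes "S \<subseteq> tuples V r" "S \<subseteq> lists U" "f ` U \<subseteq> V'"
  shows "map f ` S \<subseteq> tuples V' r"
proof
  fix ys assume "ys \<in> map f ` S"
  then obtain xs where xs: "xs \<in> S" "ys = map f xs" by blast
  then have "set xs \<subseteq> U" "length xs = r"
    using assms(1,2) by (auto simp: tuples_def in_lists_conv_set)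
  then show "ys \<in> tuples V' r" using assms(3) xs(2) unfolding tuples_def by auto
qed

lemma matching_upd:
  assumes "matching f U V V' \<rho> \<rho>'" "S \<subseteq> lists U"
  shows "matching f U V V' (\<rho>(X := S)) (\<rho>'(X := map f ` S))"
  using assms by (simp add: matching_def)

text \<open>Answering the quantifier moves the support of the chosen relation into the matching.
  This spends at most \<open>arity X * m ^ k\<close> of the reserve and leaves \<open>N\<close> for
  \<phi>. Equal rounded logarithms give both sides the same size limit.\<close>

lemma transfers_ExLog:
  assumes IH: "transfers V V' N \<phi>" and fin: "finite V" "finite V'"
    and clog: "clog (card V) = m" "clog (card V') = m"
  shows "transfers V V' (N + arity X * m ^ k) (ExLog k X \<phi>)"
proof (rule transfersI)
  fix f U a b \<rho> \<rho>'
  let ?n = "arity X * m ^ k"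
  assume m: "matching f U V V' \<rho> \<rho>'"
    and le: "card U + (N + ?n) \<le> card V" "card U + (N + ?n) \<le> card V'"
    and a: "a ` elem_vars (ExLog k X \<phi>) \<subseteq> U"
    and b: "\<forall>x\<in>elem_vars (ExLog k X \<phi>). b x = f (a x)"
  \<comment> \<open>This serves both directions: the relation is always described on the side of
    \<open>V\<close>, and its image is used on the side of \<open>V'\<close>.\<close>
  have step: "sat V {} \<phi> a (\<rho>(X := S)) \<longleftrightarrow> sat V' {} \<phi> b (\<rho>'(X := map h ` S))"
    if h: "matching h (U \<union> T) V V' \<rho> \<rho>'" "\<forall>u\<in>U. h u = f u" and T: "card T \<le> ?n"
      and S: "S \<subseteq> lists (U \<union> T)" for h T S
  proof (rule transfersD[OF IH matching_upd[OF h(1) S]])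
    have "card (U \<union> T) \<le> card U + ?n" using card_Un_le[of U T] T by simp
    then show "card (U \<union> T) + N \<le> card V" "card (U \<union> T) + N \<le> card V'" using le by auto
    show "a ` elem_vars \<phi> \<subseteq> U \<union> T" using a by auto
    fix x assume "x \<in> elem_vars \<phi>"
    then show "b x = h (a x)" using a b h(2) by auto
  qed
  show "sat V {} (ExLog k X \<phi>) a \<rho> \<longleftrightarrow> sat V' {} (ExLog k X \<phi>) b \<rho>'"
  proof
    assume "sat V {} (ExLog k X \<phi>) a \<rho>"
    then obtain S where S: "S \<subseteq> tuples V (arity X)" "card S \<le> m ^ k" "sat V {} \<phi> a (\<rho>(X := S))"
      using clog by auto
    let ?T = "\<Union> (set ` S)"
    note T = support_tuples[OF fin(1) S(1,2)]
    have "card U + card ?T \<le> card V'" using T(2) le by simp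
    from matching_forth[OF m fin T(1) this] obtain h
      where h: "matching h (U \<union> ?T) V V' \<rho> \<rho>'" "\<forall>u\<in>U. h u = f u" by blast
    have SU: "S \<subseteq> lists (U \<union> ?T)" by (auto simp: in_lists_conv_set)
    have "sat V' {} \<phi> b (\<rho>'(X := map h ` S))" using step[OF h T(2) SU] S(3) by simp
    moreover have "map h ` S \<subseteq> tuples V' (arity X)"
      by (rule map_image_tuples[OF S(1) SU]) (use h(1) in \<open>simp add: matching_def\<close>)
    moreover have "finite S" using S(1) fin finite_tuples finite_subset by blast
    then have "card (map h ` S) \<le> m ^ k" using S(2) card_image_le le_trans by blast
    ultimately show "sat V' {} (ExLog k X \<phi>) b \<rho>'" using clog by auto
  next
    assume "sat V' {} (ExLog k X \<phi>) b \<rho>'"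
    then obtain S' where S': "S' \<subseteq> tuples V' (arity X)" "card S' \<le> m ^ k"
        "sat V' {} \<phi> b (\<rho>'(X := S'))"
      using clog by auto
    let ?T = "\<Union> (set ` S')"
    note T = support_tuples[OF fin(2) S'(1,2)]
    have "card U + card ?T \<le> card V" using T(2) le by simp
    from matching_back[OF m fin T(1) this] obtain h W
      where h: "matching h (U \<union> W) V V' \<rho> \<rho>'" "\<forall>u\<in>U. h u = f u"
        and W: "card W \<le> card ?T" "?T \<subseteq> h ` (U \<union> W)" by blast
    \<comment> \<open>A relation chosen in \<open>V'\<close> is pulled back along the inverse of
      \<open>h\<close>. Its support lies in the range of \<open>h\<close>, so pushing the pullback
      forward gives back exactly \<open>S'\<close>.\<close>
    let ?g = "inv_into (U \<union> W) h"
    let ?S = "map ?g ` S'"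
    have ST: "S' \<subseteq> lists (h ` (U \<union> W))" using W(2) by (auto simp: in_lists_conv_set)
    have img: "?g ` h ` (U \<union> W) \<subseteq> U \<union> W" by (meson image_subsetI inv_into_into)
    have SU: "?S \<subseteq> lists (U \<union> W)"
      using ST img by (fastforce simp: in_lists_conv_set)
    have "map h (map ?g ys) = ys" if "ys \<in> S'" for ys
      using that ST by (auto simp: in_lists_conv_set f_inv_into_f intro!: map_idI)
    then have hS: "map h ` ?S = S'" by (auto simp: image_iff)
    have "card W \<le> ?n" using W(1) T(2) by simp
    then have "sat V {} \<phi> a (\<rho>(X := ?S))" using step[OF h _ SU] S'(3) hS by simp
    moreover have "?S \<subseteq> tuples V (arity X)"
      by (rule map_image_tuples[OF S'(1) ST], rule order_trans[OF img])
        (use h(1) in \<open>simp add: matching_def\<close>)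
    moreover have "finite S'" using S'(1) fin finite_tuples finite_subset by blast
    then have "card ?S \<le> m ^ k" using S'(2) card_image_le le_trans by blast
    ultimately show "sat V {} (ExLog k X \<phi>) a \<rho>" using clog by auto
  qed
qed

section \<open>Polynomial reserves for all formulas of the logic\<close>

lemma monomial_mono:
  fixes m :: nat
  assumes "m > 0" "c \<le> d"
  shows "c * m ^ c \<le> d * m ^ d"
  using assms by (intro mult_mono power_increasing) auto

text \<open>One number serves as coefficient and as exponent: \<open>c + r + k\<close> dominates the
  coefficient sum \<open>c + r\<close> and both exponents.\<close>

lemma ExLog_bound:
  fixes m :: nat
  assumes "m > 0"
  shows "c * m ^ c + r * m ^ k \<le> (c + r + k) * m ^ (c + r + k)"
proof -
  have "c * m ^ c + r * m ^ k \<le> c * m ^ (c + r + k) + r * m ^ (c + r + k)"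
    using assms by (intro add_mono mult_left_mono power_increasing) auto
  also have "\<dots> \<le> (c + r + k) * m ^ (c + r + k)" by (simp add: algebra_simps)
  finally show ?thesis .
qed

text \<open>The constant \<open>c\<close> depends on the formula alone and precedes the vertex sets
  and \<open>m\<close>, so \<open>m\<close> can be chosen large afterwards. The universal quantifier
  is the existential one between two negations, which leave the reserve unchanged.\<close>

lemma Llog_transfers:
  assumes "\<phi> \<in> Llog"
  shows "\<exists>c. \<forall>(V :: 'v set) (V' :: 'w set) m. m > 0 \<longrightarrow> finite V \<longrightarrow> finite V' \<longrightarrow>
    clog (card V) = m \<longrightarrow> clog (card V') = m \<longrightarrow> transfers V V' (c * m ^ c) \<phi>"
    (is "\<exists>c. ?P c \<phi>")
  using assms
proof induction
  case (Linf \<phi>)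
  then have \<phi>: "infinitary \<phi>" "finite (elem_vars \<phi>)"
    unfolding Linf_omega_def Linf_def by auto
  show ?case
  proof (intro exI allI impI)
    fix V :: "'v set" and V' :: "'w set" and m :: nat
    assume "m > 0" and "finite V" "finite V'"
    then show "transfers V V' (card (elem_vars \<phi>) * m ^ card (elem_vars \<phi>)) \<phi>"
      by (intro transfers_mono[OF transfers_infinitary[OF \<phi>]]) auto
  qed
next
  case (ExLog \<phi> k X)
  then obtain c where "?P c \<phi>" by blast
  then have "?P (c + arity X + k) (ExLog k X \<phi>)"
    by (blast intro: transfers_mono[OF transfers_ExLog] ExLog_bound)
  then show ?case ..
next
  case (AllLog \<phi> k X)
  then obtain c where "?P c \<phi>" by blast
  then have "?P (c + arity X + k) (AllLog k X \<phi>)"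
    by (blast intro: transfers_Neg transfers_mono[OF transfers_ExLog] ExLog_bound)
  then show ?case ..
next
  case (And \<phi> \<psi>)
  from And.IH(1) obtain c where c: "?P c \<phi>" ..
  from And.IH(2) obtain d where d: "?P d \<psi>" ..
  have "?P (c + d) (And \<phi> \<psi>)"
  proof (intro allI impI transfers_And)
    fix V :: "'v set" and V' :: "'w set" and m :: nat
    assume m: "m > 0" and V: "finite V" "finite V'" "clog (card V) = m" "clog (card V') = m"
    show "transfers V V' ((c + d) * m ^ (c + d)) \<phi>"
      by (rule transfers_mono[OF c[rule_format, OF m V] monomial_mono[OF m le_add1]])
    show "transfers V V' ((c + d) * m ^ (c + d)) \<psi>"
      by (rule transfers_mono[OF d[rule_format, OF m V] monomial_mono[OF m le_add2]])
  qed
  then show ?case ..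
next
  case (Or \<phi> \<psi>)
  from Or.IH(1) obtain c where c: "?P c \<phi>" ..
  from Or.IH(2) obtain d where d: "?P d \<psi>" ..
  have "?P (c + d) (Or \<phi> \<psi>)"
  proof (intro allI impI transfers_Or)
    fix V :: "'v set" and V' :: "'w set" and m :: nat
    assume m: "m > 0" and V: "finite V" "finite V'" "clog (card V) = m" "clog (card V') = m"
    show "transfers V V' ((c + d) * m ^ (c + d)) \<phi>"
      by (rule transfers_mono[OF c[rule_format, OF m V] monomial_mono[OF m le_add1]])
    show "transfers V V' ((c + d) * m ^ (c + d)) \<psi>"
      by (rule transfers_mono[OF d[rule_format, OF m V] monomial_mono[OF m le_add2]])
  qed
  then show ?case ..
qed

section \<open>Truth of sentences under a fixed assignment\<close>

lemma sat_cong: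
  assumes "\<And>x. x \<in> free_elem_vars \<phi> \<Longrightarrow> a x = b x" "\<And>X. X \<in> free_rel_vars \<phi> \<Longrightarrow> \<rho> X = \<sigma> X"
  shows "sat V E \<phi> a \<rho> \<longleftrightarrow> sat V E \<phi> b \<sigma>"
  using assms
proof (induction \<phi> arbitrary: a b \<rho> \<sigma>)
  case (Rel X xs)
  then have "map a xs = map b xs" by simp
  with Rel show ?case by (metis free_rel_vars.simps(3) insertI1 sat.simps(3))
next
  case (Neg \<phi>)
  have "sat V E \<phi> a \<rho> \<longleftrightarrow> sat V E \<phi> b \<sigma>" by (rule Neg.IH) (use Neg.prems in auto)
  then show ?case by simp
next
  case (And \<phi> \<psi>)
  have "sat V E \<phi> a \<rho> \<longleftrightarrow> sat V E \<phi> b \<sigma>" by (rule And.IH) (use And.prems in auto)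
  moreover have "sat V E \<psi> a \<rho> \<longleftrightarrow> sat V E \<psi> b \<sigma>" by (rule And.IH) (use And.prems in auto)
  ultimately show ?case by simp
next
  case (Or \<phi> \<psi>)
  have "sat V E \<phi> a \<rho> \<longleftrightarrow> sat V E \<phi> b \<sigma>" by (rule Or.IH) (use Or.prems in auto)
  moreover have "sat V E \<psi> a \<rho> \<longleftrightarrow> sat V E \<psi> b \<sigma>" by (rule Or.IH) (use Or.prems in auto)
  ultimately show ?case by simp
next
  case (BigAnd I F)
  have "sat V E (F i) a \<rho> \<longleftrightarrow> sat V E (F i) b \<sigma>" if "i \<in> I" for i
    by (rule BigAnd.IH) (use that BigAnd.prems in auto)
  then show ?case by simp
next
  case (BigOr I F)
  have "sat V E (F i) a \<rho> \<longleftrightarrow> sat V E (F i) b \<sigma>" if "i \<in> I" for i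
    by (rule BigOr.IH) (use that BigOr.prems in auto)
  then show ?case by simp
next
  case (Ex x \<phi>)
  have "sat V E \<phi> (a(x := v)) \<rho> \<longleftrightarrow> sat V E \<phi> (b(x := v)) \<sigma>" for v
    by (rule Ex.IH) (use Ex.prems in auto)
  then show ?case by simp
next
  case (All x \<phi>)
  have "sat V E \<phi> (a(x := v)) \<rho> \<longleftrightarrow> sat V E \<phi> (b(x := v)) \<sigma>" for v
    by (rule All.IH) (use All.prems in auto)
  then show ?case by simp
next
  case (ExLog k X \<phi>)
  have "sat V E \<phi> a (\<rho>(X := S)) \<longleftrightarrow> sat V E \<phi> b (\<sigma>(X := S))" for S
    by (rule ExLog.IH) (use ExLog.prems in auto)
  then show ?case by simp
qed simp_all

text \<open>The vertex \<open>v\<close> provides an admissible assignment, so the universal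
  quantification in \<open>models\<close> is not vacuous.\<close>

lemma models_sentence_iff:
  assumes "sentence \<phi>" "v \<in> V"
  shows "models V E \<phi> \<longleftrightarrow> sat V E \<phi> (\<lambda>_. v) (\<lambda>_. {})"
proof -
  have "sat V E \<phi> a \<rho> \<longleftrightarrow> sat V E \<phi> (\<lambda>_. v) (\<lambda>_. {})" for a \<rho>
    using assms(1) unfolding sentence_def by (intro sat_cong) auto
  moreover have "range (\<lambda>_. v) \<subseteq> V" using assms(2) by auto
  ultimately show ?thesis unfolding models_def by (metis empty_subsetI)
qed

section \<open>Orders of different parity with equal rounded logarithm\<close>

lemma clog_power: "clog (2 ^ m) = m"
  by (simp add: clog_def log_nat_power)

text \<open>The number lies strictly above \<open>2 ^ (m - 1)\<close>, so its logarithm rounds up to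
  \<open>m\<close>. At \<open>m = 1\<close> this fails: the number is 1, with logarithm 0.\<close>

lemma clog_power_minus_1:
  assumes "m \<ge> 2"
  shows "clog (2 ^ m - 1) = m"
proof -
  obtain j where j: "m = Suc j" "j \<ge> 1" using assms by (cases m) auto
  have "(2::real) ^ j \<ge> 2" using power_increasing[of 1 j "2::real"] j by simp
  then have "(2::real) ^ j < 2 ^ m - 1" using j by simp
  then have "log 2 (2 ^ j) < log 2 ((2::real) ^ m - 1)" by (intro log_less) auto
  moreover have "log 2 ((2::real) ^ m - 1) \<le> log 2 (2 ^ m)"
    using assms by (intro log_mono) (auto intro: one_less_power)
  moreover have "log 2 ((2::real) ^ n) = real n" for n by (simp add: log_nat_power)
  ultimately have "real j < log 2 ((2::real) ^ m - 1)" "log 2 ((2::real) ^ m - 1) \<le> real m"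
    by metis+
  then have "\<lceil>log 2 ((2::real) ^ m - 1)\<rceil> = int m"
    by (intro ceiling_unique) (simp_all add: j(1))
  then show ?thesis by (simp add: clog_def of_nat_diff)
qed

text \<open>The right side is the smaller of the two orders; the summand 1 on the left pays for the
  single vertex matched at the start.\<close>

lemma exists_large_power:
  fixes c :: nat
  shows "\<exists>m\<ge>2. 1 + c * m ^ c \<le> 2 ^ m - 1"
proof -
  \<comment> \<open>The constant 2 absorbs the subtracted 1, so no truncated subtraction enters the
    asymptotic estimate.\<close>
  have "eventually (\<lambda>m. 2 + real c * real m ^ c \<le> 2 ^ m) at_top"
    by real_asymp
  with eventually_ge_at_top[of 2] have "eventually (\<lambda>m. m \<ge> 2 \<and> 2 + real c * real m ^ c \<le> 2 ^ m) at_top"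
    by eventually_elim simp
  then obtain m where m: "m \<ge> 2" "2 + real c * real m ^ c \<le> 2 ^ m"
    by (auto simp: eventually_at_top_linorder)
  then have "real (2 + c * m ^ c) \<le> real (2 ^ m)" by simp
  then have "2 + c * m ^ c \<le> 2 ^ m" by (simp only: of_nat_le_iff)
  then show ?thesis using m(1) by (intro exI[of _ m]) auto
qed

theorem theorem4p4:
  "\<not> (\<exists>\<phi> :: 'i fm. \<phi> \<in> Llog \<and> sentence \<phi> \<and>
        (\<forall>(V :: 'v::infinite set) E. finite_graph V E \<longrightarrow> (models V E \<phi> \<longleftrightarrow> even (card V))))"
proof
  assume "\<exists>\<phi> :: 'i fm. \<phi> \<in> Llog \<and> sentence \<phi> \<and>
    (\<forall>(V :: 'v set) E. finite_graph V E \<longrightarrow> (models V E \<phi> \<longleftrightarrow> even (card V)))"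
  then obtain \<phi> :: "'i fm" where \<phi>: "\<phi> \<in> Llog" "sentence \<phi>"
    and even: "\<And>(V :: 'v set) E. finite_graph V E \<Longrightarrow> models V E \<phi> \<longleftrightarrow> even (card V)"
    by blast
  obtain c where c: "\<And>(V :: 'v set) (V' :: 'v set) m. m > 0 \<Longrightarrow> finite V \<Longrightarrow> finite V' \<Longrightarrow>
    clog (card V) = m \<Longrightarrow> clog (card V') = m \<Longrightarrow> transfers V V' (c * m ^ c) \<phi>"
    using Llog_transfers[OF \<phi>(1)] by blast
  obtain m where m: "m \<ge> 2" "1 + c * m ^ c \<le> 2 ^ m - 1" using exists_large_power by blast
  obtain V :: "'v set" where V: "finite V" "card V = 2 ^ m - 1"
    using infinite_arbitrarily_large[OF infinite_UNIV] by blast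
  obtain V' :: "'v set" where V': "finite V'" "card V' = 2 ^ m"
    using infinite_arbitrarily_large[OF infinite_UNIV] by blast
  obtain v v' where v: "v \<in> V" "v' \<in> V'"
    using V V' m(2) by (fastforce simp flip: card_gt_0_iff)
  have "transfers V V' (c * m ^ c) \<phi>"
    using c m(1) V V' clog_power clog_power_minus_1 by simp
  \<comment> \<open>The domain is one vertex rather than empty because the assignments are total and
    their values must be matched.\<close>
  moreover have "matching (\<lambda>_. v') {v} V V' (\<lambda>_. {}) (\<lambda>_. {})"
    using v by (simp add: matching_def)
  ultimately have "sat V {} \<phi> (\<lambda>_. v) (\<lambda>_. {}) \<longleftrightarrow> sat V' {} \<phi> (\<lambda>_. v') (\<lambda>_. {})"
    using m V V' by (intro transfersD) auto
  then have "models V {} \<phi> \<longleftrightarrow> models V' {} \<phi>"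
    by (simp add: models_sentence_iff[OF \<phi>(2) v(1)] models_sentence_iff[OF \<phi>(2) v(2)])
  moreover have "finite_graph V {}" "finite_graph V' {}"
    using V V' v by (auto simp: finite_graph_def)
  ultimately have "even (card V) \<longleftrightarrow> even (card V')" by (simp add: even)
  then show False using V V' m(1) by simp
qed

end
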